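(* For every $C>0$ there exists an analytic trigonometric polynomial $f$ on the torus $\mathbb{T}^2$ such that \[ \|D^2_{xx}f\|_\infty+\|D^2_{yy}f\|_\infty\leq 1 \] but \[ \|D^2_{xy}f\|_\infty>C . \]
   Context: $\mathbb{T}^2=(\mathbb{R}/2\pi\mathbb{Z})^2$ with coordinates $(x,y)$. A trigonometric polynomial is a finite sum $f(x,y)=\sum_{n\in\mathbb{Z}^2}\widehat f(n)e^{i(n_1x+n_2y)}$ with complex coefficients. It is called analytic if $\widehat f(n)=0$ for all $n=(n_1,n_2)$ outside the set $\{n\in\mathbb{Z}^2: n_1\ge 0,\ n_2\ge 0\}$. $D^2_{xx}, D^2_{yy}, D^2_{xy}$ denote the second order partial derivatives $\partial^2/\partial x^2$, $\partial^2/\partial y^2$, $\partial^2/\partial x\partial y$, and $\|\cdot\|_\infty$ is the supremum norm on $\mathbb{T}^2$. *)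

theory Defs
  imports "HOL-Analysis.Analysis"
begin

text \<open>
  A function on the torus \<open>(\<real>/2\<pi>\<int>)\<^sup>2\<close> is represented by its lift to the plane, a
  doubly \<open>2\<pi>\<close>-periodic function \<open>real \<Rightarrow> real \<Rightarrow> complex\<close>.
\<close>

definition trig_sum :: "(int \<times> int \<Rightarrow> complex) \<Rightarrow> real \<Rightarrow> real \<Rightarrow> complex" where
  "trig_sum c x y =
     (\<Sum>n | c n \<noteq> 0. c n * exp (\<i> * complex_of_real (of_int (fst n) * x + of_int (snd n) * y)))"

text \<open>
  A trigonometric polynomial determines its finitely supported coefficient family \<open>c\<close>,
  so the existential quantifier below is over a unique object.
\<close>

definition analytic_trig_polynomial :: "(real \<Rightarrow> real \<Rightarrow> complex) \<Rightarrow> bool" where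
  "analytic_trig_polynomial f \<longleftrightarrow>
     (\<exists>c. finite {n. c n \<noteq> 0} \<and> f = trig_sum c \<and>
          (\<forall>n. \<not> (fst n \<ge> 0 \<and> snd n \<ge> 0) \<longrightarrow> c n = 0))"

definition partial_x :: "(real \<Rightarrow> real \<Rightarrow> complex) \<Rightarrow> real \<Rightarrow> real \<Rightarrow> complex" where
  "partial_x f x y = vector_derivative (\<lambda>t. f t y) (at x)"

definition partial_y :: "(real \<Rightarrow> real \<Rightarrow> complex) \<Rightarrow> real \<Rightarrow> real \<Rightarrow> complex" where
  "partial_y f x y = vector_derivative (\<lambda>t. f x t) (at y)"

definition Dxx :: "(real \<Rightarrow> real \<Rightarrow> complex) \<Rightarrow> real \<Rightarrow> real \<Rightarrow> complex" where
  "Dxx f = partial_x (partial_x f)"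

definition Dyy :: "(real \<Rightarrow> real \<Rightarrow> complex) \<Rightarrow> real \<Rightarrow> real \<Rightarrow> complex" where
  "Dyy f = partial_y (partial_y f)"

definition Dxy :: "(real \<Rightarrow> real \<Rightarrow> complex) \<Rightarrow> real \<Rightarrow> real \<Rightarrow> complex" where
  "Dxy f = partial_x (partial_y f)"

text \<open>
  The supremum over the plane equals the one over the torus by periodicity. It is taken in
  \<open>ennreal\<close>, where it is meaningful without a boundedness side condition.
\<close>

definition sup_norm :: "(real \<Rightarrow> real \<Rightarrow> complex) \<Rightarrow> ennreal" where
  "sup_norm g = (SUP p. ennreal (norm (g (fst p) (snd p))))"

end

theory Submission imports Defs
begin

text \<open>
  Average the characters \<open>exp (\<i> (m x + n y))\<close> over three small squares of frequencies far
  out in the directions \<open>m / n = 0, 1, 2\<close>, with coefficients proportional to \<open>1 / n\<^sup>2\<close>. Each average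
  is then essentially an eigenvector of the second derivatives, normalised so that \<open>D\<^sub>y\<^sub>y\<close>,
  \<open>D\<^sub>x\<^sub>y\<close>, \<open>D\<^sub>x\<^sub>x\<close> act as minus \<open>1\<close>, \<open>m / n\<close>, \<open>(m / n)\<^sup>2\<close>. A linear combination of the three makes
  \<open>D\<^sub>x\<^sub>x\<close> and \<open>D\<^sub>y\<^sub>y\<close> nearly vanish at the origin while \<open>D\<^sub>x\<^sub>y\<close> does not; away from the origin
  everything is small, because the averages are products of normalised Dirichlet kernels.
  Superposing such blocks, each concentrated where the pure derivatives of the previous ones
  are still small, keeps \<open>D\<^sub>x\<^sub>x\<close> and \<open>D\<^sub>y\<^sub>y\<close> bounded, whereas \<open>D\<^sub>x\<^sub>y\<close> at the origin grows
  linearly in the number of blocks.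
\<close>

section \<open>Trigonometric sums\<close>

definition character :: "int \<times> int \<Rightarrow> real \<Rightarrow> real \<Rightarrow> complex" where
  "character n x y = exp (\<i> * complex_of_real (of_int (fst n) * x + of_int (snd n) * y))"

lemma character_nonneg:
  "character (int a, int b) x y = cis x ^ a * cis y ^ b"
  by (simp add: character_def cis_conv_exp exp_of_nat_mult[symmetric] exp_add[symmetric] algebra_simps)

lemma trig_sum_superset:
  assumes "finite S" "{n. c n \<noteq> 0} \<subseteq> S"
  shows "trig_sum c x y = (\<Sum>n\<in>S. c n * character n x y)"
  unfolding trig_sum_def character_def
  by (rule sum.mono_neutral_left) (use assms in auto)

lemma trig_sum_add:
  assumes "finite {n. c n \<noteq> 0}" "finite {n. d n \<noteq> 0}"
  shows "trig_sum (\<lambda>n. c n + d n) x y = trig_sum c x y + trig_sum d x y"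
proof -
  let ?S = "{n. c n \<noteq> 0} \<union> {n. d n \<noteq> 0}"
  have "finite ?S" using assms by simp
  then show ?thesis
    by (subst (1 2 3) trig_sum_superset[of ?S]) (auto simp: sum.distrib algebra_simps)
qed

lemma trig_sum_cmult:
  assumes "finite {n. c n \<noteq> 0}"
  shows "trig_sum (\<lambda>n. a * c n) x y = a * trig_sum c x y"
  by (subst (1 2) trig_sum_superset[OF assms])
    (auto simp: sum_distrib_left mult.assoc)

text \<open>The map \<open>g\<close> may repeat values: contributions to the same frequency simply
  add up. A block can therefore be evaluated over its index triples with no check that its
  frequencies are distinct. The factor \<open>h\<close> leaves room for the multiplier of a
  derivative.\<close>

lemma trig_sum_of_family:
  assumes "finite I"
  shows "trig_sum (\<lambda>n. h n * (\<Sum>i\<in>I. if n = g i then d i else 0)) x y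
           = (\<Sum>i\<in>I. h (g i) * d i * character (g i) x y)"
proof -
  have "h n * (\<Sum>i\<in>I. if n = g i then d i else 0) = 0" if "n \<notin> g ` I" for n
  proof -
    have "(\<Sum>i\<in>I. if n = g i then d i else 0) = 0"
      by (rule sum.neutral) (use that in auto)
    then show ?thesis by simp
  qed
  then have "trig_sum (\<lambda>n. h n * (\<Sum>i\<in>I. if n = g i then d i else 0)) x y
      = (\<Sum>n\<in>g ` I. h n * (\<Sum>i\<in>I. if n = g i then d i else 0) * character n x y)"
    by (intro trig_sum_superset) (use assms in auto)
  also have "\<dots> = (\<Sum>n\<in>g ` I. \<Sum>i\<in>I. if n = g i then h n * d i * character n x y else 0)"
    by (auto simp: sum_distrib_left sum_distrib_right intro!: sum.cong)
  also have "\<dots> = (\<Sum>i\<in>I. \<Sum>n\<in>g ` I. if n = g i then h n * d i * character n x y else 0)"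
    by (rule sum.swap)
  also have "\<dots> = (\<Sum>i\<in>I. h (g i) * d i * character (g i) x y)"
    using assms by (intro sum.cong) auto
  finally show ?thesis .
qed

section \<open>Differentiation as multiplication of coefficients\<close>

lemma finite_support_mult:
  fixes c :: "'a \<Rightarrow> 'b::mult_zero"
  shows "finite {n. c n \<noteq> 0} \<Longrightarrow> finite {n. h n * c n \<noteq> 0}"
  by (erule finite_subset[rotated]) auto

lemma partial_x_trig_sum:
  assumes "finite {n. c n \<noteq> 0}"
  shows "partial_x (trig_sum c) = trig_sum (\<lambda>n. (\<i> * of_int (fst n)) * c n)"
proof (intro ext)
  fix x y
  let ?S = "{n. c n \<noteq> 0}"
  have "((\<lambda>t. \<Sum>n\<in>?S. c n * character n t y) has_vector_derivative
      (\<Sum>n\<in>?S. (\<i> * of_int (fst n)) * c n * character n x y)) (at x)"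
    unfolding character_def
    by (auto intro!: derivative_eq_intros has_vector_derivative_real_field sum.cong
        simp: algebra_simps)
  moreover have "trig_sum c = (\<lambda>x y. \<Sum>n\<in>?S. c n * character n x y)"
    by (intro ext trig_sum_superset assms) auto
  moreover have "trig_sum (\<lambda>n. (\<i> * of_int (fst n)) * c n) x y
      = (\<Sum>n\<in>?S. (\<i> * of_int (fst n)) * c n * character n x y)"
    by (intro trig_sum_superset assms) auto
  ultimately show "partial_x (trig_sum c) x y = trig_sum (\<lambda>n. (\<i> * of_int (fst n)) * c n) x y"
    unfolding partial_x_def by (simp only: vector_derivative_at)
qed

lemma partial_y_trig_sum:
  assumes "finite {n. c n \<noteq> 0}"
  shows "partial_y (trig_sum c) = trig_sum (\<lambda>n. (\<i> * of_int (snd n)) * c n)"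
proof (intro ext)
  fix x y
  let ?S = "{n. c n \<noteq> 0}"
  have "((\<lambda>t. \<Sum>n\<in>?S. c n * character n x t) has_vector_derivative
      (\<Sum>n\<in>?S. (\<i> * of_int (snd n)) * c n * character n x y)) (at y)"
    unfolding character_def
    by (auto intro!: derivative_eq_intros has_vector_derivative_real_field sum.cong
        simp: algebra_simps)
  moreover have "trig_sum c = (\<lambda>x y. \<Sum>n\<in>?S. c n * character n x y)"
    by (intro ext trig_sum_superset assms) auto
  moreover have "trig_sum (\<lambda>n. (\<i> * of_int (snd n)) * c n) x y
      = (\<Sum>n\<in>?S. (\<i> * of_int (snd n)) * c n * character n x y)"
    by (intro trig_sum_superset assms) auto
  ultimately show "partial_y (trig_sum c) x y = trig_sum (\<lambda>n. (\<i> * of_int (snd n)) * c n) x y"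
    unfolding partial_y_def by (simp only: vector_derivative_at)
qed

text \<open>The exponents \<open>p\<close> and \<open>q\<close> allow all second derivatives to be
  treated at once. The factor \<open>\<i>\<close> of each differentiation is left out, so for
  \<open>p + q = 2\<close> this is the coefficient family of minus the derivative.\<close>

definition moment :: "nat \<Rightarrow> nat \<Rightarrow> (int \<times> int \<Rightarrow> complex) \<Rightarrow> int \<times> int \<Rightarrow> complex" where
  "moment p q c n = of_int (fst n) ^ p * of_int (snd n) ^ q * c n"

lemma finite_support_moment:
  "finite {n. c n \<noteq> 0} \<Longrightarrow> finite {n. moment p q c n \<noteq> 0}"
  unfolding moment_def by (rule finite_support_mult)

lemma second_derivatives_trig_sum:
  assumes "finite {n. c n \<noteq> 0}"
  shows "Dxx (trig_sum c) x y = - trig_sum (moment 2 0 c) x y"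
    and "Dyy (trig_sum c) x y = - trig_sum (moment 0 2 c) x y"
    and "Dxy (trig_sum c) x y = - trig_sum (moment 1 1 c) x y"
proof -
  have *: "- trig_sum (moment p q c) x y = trig_sum (\<lambda>n. - 1 * moment p q c n) x y" for p q
    using trig_sum_cmult[OF finite_support_moment[OF assms], of "- 1"] by simp
  show "Dxx (trig_sum c) x y = - trig_sum (moment 2 0 c) x y"
    unfolding Dxx_def * partial_x_trig_sum[OF assms]
    by (subst partial_x_trig_sum[OF finite_support_mult[OF assms]])
      (intro arg_cong[where f = "\<lambda>c. trig_sum c x y"] ext,
        simp add: moment_def power2_eq_square algebra_simps)
  show "Dyy (trig_sum c) x y = - trig_sum (moment 0 2 c) x y"
    unfolding Dyy_def * partial_y_trig_sum[OF assms]
    by (subst partial_y_trig_sum[OF finite_support_mult[OF assms]])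
      (intro arg_cong[where f = "\<lambda>c. trig_sum c x y"] ext,
        simp add: moment_def power2_eq_square algebra_simps)
  show "Dxy (trig_sum c) x y = - trig_sum (moment 1 1 c) x y"
    unfolding Dxy_def * partial_y_trig_sum[OF assms]
    by (subst partial_x_trig_sum[OF finite_support_mult[OF assms]])
      (intro arg_cong[where f = "\<lambda>c. trig_sum c x y"] ext,
        simp add: moment_def algebra_simps)
qed

section \<open>Coefficients in the quadrant and continuity at the origin\<close>

definition analytic_coeffs :: "(int \<times> int \<Rightarrow> complex) \<Rightarrow> bool" where
  "analytic_coeffs c \<longleftrightarrow>
     finite {n. c n \<noteq> 0} \<and> (\<forall>n. \<not> (fst n \<ge> 0 \<and> snd n \<ge> 0) \<longrightarrow> c n = 0)"

lemma analytic_coeffs_moment: "analytic_coeffs c \<Longrightarrow> analytic_coeffs (moment p q c)"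
  by (auto simp: analytic_coeffs_def finite_support_moment) (auto simp: moment_def)

lemma analytic_coeffs_add:
  assumes "analytic_coeffs c" "analytic_coeffs d"
  shows "analytic_coeffs (\<lambda>n. c n + d n)"
proof -
  have "{n. c n + d n \<noteq> 0} \<subseteq> {n. c n \<noteq> 0} \<union> {n. d n \<noteq> 0}" by auto
  then show ?thesis using assms
    unfolding analytic_coeffs_def by (auto intro: finite_subset)
qed

text \<open>Neighbourhoods of the origin of the torus are measured by \<open>cis x - 1\<close>, which makes
  them periodic.\<close>

lemma trig_sum_continuous_at_0:
  assumes "analytic_coeffs c" "\<eta> > 0"
  shows "\<exists>\<delta>>0. \<forall>x y. norm (cis x - 1) < \<delta> \<longrightarrow> norm (cis y - 1) < \<delta> \<longrightarrow>
           norm (trig_sum c x y - trig_sum c 0 0) < \<eta>"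
proof -
  let ?S = "{n. c n \<noteq> 0}"
  \<comment> \<open>Since all frequencies in the support are nonnegative, the sum is a genuine
    polynomial in \<open>(cis x, cis y)\<close>. Continuity of this polynomial at
    \<open>(1, 1)\<close> gives a neighbourhood that is already periodic.\<close>
  define p where "p = (\<lambda>u :: complex \<times> complex.
    \<Sum>n\<in>?S. c n * (fst u ^ nat (fst n) * snd u ^ nat (snd n)))"
  have fin: "finite ?S" using assms(1) by (simp add: analytic_coeffs_def)
  have "character n x y = cis x ^ nat (fst n) * cis y ^ nat (snd n)"
    if "n \<in> ?S" for n x y
  proof -
    have "n = (int (nat (fst n)), int (nat (snd n)))"
      using that assms(1) by (cases n) (auto simp: analytic_coeffs_def)
    then show ?thesis using character_nonneg by metis
  qed
  then have eq: "trig_sum c x y = p (cis x, cis y)" for x y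
    unfolding p_def by (subst trig_sum_superset[OF fin]) (auto intro!: sum.cong)
  have "isCont p (1, 1)" unfolding p_def by (intro continuous_intros)
  then obtain \<epsilon> where \<epsilon>: "\<epsilon> > 0" "\<And>u. dist u (1, 1) < \<epsilon> \<Longrightarrow> dist (p u) (p (1, 1)) < \<eta>"
    using assms(2) unfolding continuous_at_eps_delta by blast
  show ?thesis
  proof (intro exI[of _ "\<epsilon> / 2"] conjI allI impI)
    fix x y assume "norm (cis x - 1) < \<epsilon> / 2" "norm (cis y - 1) < \<epsilon> / 2"
    then have "dist (cis x, cis y) (1, 1) < \<epsilon>"
      using sqrt_sum_squares_le_sum_abs[of "dist (cis x) 1" "dist (cis y) 1"]
      unfolding dist_Pair_Pair unfolding dist_norm by simp
    from \<epsilon>(2)[OF this] show "norm (trig_sum c x y - trig_sum c 0 0) < \<eta>"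
      by (simp add: eq dist_norm)
  qed (use \<epsilon> in auto)
qed

section \<open>A single block\<close>

text \<open>For \<open>z = cis x\<close> this is, up to a unimodular factor, the normalised
  Dirichlet kernel.\<close>

definition geo_mean :: "nat \<Rightarrow> complex \<Rightarrow> complex" where
  "geo_mean M z = (\<Sum>k<M. z ^ k) / of_nat M"

lemma norm_geo_mean_le_1:
  assumes "norm z = 1"
  shows "norm (geo_mean M z) \<le> 1"
proof -
  have "norm (\<Sum>k<M. z ^ k) \<le> (\<Sum>k<M. 1)"
    by (rule sum_norm_le) (simp add: norm_power assms)
  then show ?thesis by (cases "M = 0") (auto simp: geo_mean_def norm_divide divide_simps)
qed

text \<open>In the closed form of the geometric sum the numerator has norm at most 2 and the
  denominator at least \<open>\<delta>\<close>. Large \<open>M\<close> thus concentrates the mean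
  near \<open>z = 1\<close>.\<close>

lemma norm_geo_mean_le:
  assumes "norm z = 1" "M > 0" "\<delta> > 0" "norm (z - 1) \<ge> \<delta>"
  shows "norm (geo_mean M z) \<le> 2 / (M * \<delta>)"
proof -
  have "z \<noteq> 1" using assms by auto
  then have "geo_mean M z = (z ^ M - 1) / (z - 1) / of_nat M"
    by (simp add: geo_mean_def geometric_sum)
  moreover have "norm (z ^ M - 1) \<le> 2"
    using norm_triangle_ineq4[of "z ^ M" 1] by (simp add: norm_power assms)
  ultimately have "norm (geo_mean M z) \<le> 2 / norm (z - 1) / M"
    by (simp add: norm_divide norm_mult divide_right_mono del: of_nat_mult)
  also have "\<dots> \<le> 2 / \<delta> / M"
    using assms \<open>z \<noteq> 1\<close> by (intro divide_right_mono divide_left_mono) auto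
  finally show ?thesis by (simp add: mult.commute)
qed

text \<open>If \<open>\<rho> j k l\<close> were equal to \<open>\<beta> j\<close>, the double sum
  over \<open>k\<close> and \<open>l\<close> would factor into two geometric means. Replacing it
  costs at most \<open>norm (\<gamma> j) * \<epsilon> / M ^ 2\<close> in each of the
  \<open>M ^ 2\<close> terms of square \<open>j\<close>.\<close>

lemma block_approx:
  fixes \<gamma> \<beta> :: "nat \<Rightarrow> complex" and \<rho> :: "nat \<Rightarrow> nat \<Rightarrow> nat \<Rightarrow> complex"
  assumes "norm z = 1" "norm w = 1" "M > 0"
    and \<rho>: "\<And>j k l. j < J \<Longrightarrow> k < M \<Longrightarrow> l < M \<Longrightarrow> norm (\<rho> j k l - \<beta> j) \<le> \<epsilon>"
  shows "norm ((\<Sum>j<J. \<Sum>k<M. \<Sum>l<M. \<gamma> j * \<rho> j k l / of_nat M ^ 2 * (z ^ (j * R + k) * w ^ (R + l)))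
           - (\<Sum>j<J. \<gamma> j * \<beta> j * z ^ (j * R)) * w ^ R * geo_mean M z * geo_mean M w)
         \<le> (\<Sum>j<J. norm (\<gamma> j)) * \<epsilon>"
proof -
  let ?u = "\<lambda>j k l. z ^ (j * R + k) * w ^ (R + l) / of_nat M ^ 2"
  have gg: "geo_mean M z * geo_mean M w = (\<Sum>k<M. \<Sum>l<M. z ^ k * w ^ l / of_nat M ^ 2)"
    by (simp add: geo_mean_def sum_product sum_divide_distrib power2_eq_square)
  have "(\<Sum>j<J. \<gamma> j * \<beta> j * z ^ (j * R)) * w ^ R * geo_mean M z * geo_mean M w
      = (\<Sum>j<J. \<gamma> j * \<beta> j * z ^ (j * R) * w ^ R * (geo_mean M z * geo_mean M w))"
    by (simp add: sum_distrib_right mult.assoc)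
  also have "\<dots> = (\<Sum>j<J. \<Sum>k<M. \<Sum>l<M. \<gamma> j * \<beta> j * ?u j k l)"
    unfolding gg sum_distrib_left
    by (intro sum.cong refl) (simp add: power_add)
  finally have "(\<Sum>j<J. \<Sum>k<M. \<Sum>l<M. \<gamma> j * \<rho> j k l / of_nat M ^ 2 * (z ^ (j * R + k) * w ^ (R + l)))
           - (\<Sum>j<J. \<gamma> j * \<beta> j * z ^ (j * R)) * w ^ R * geo_mean M z * geo_mean M w
      = (\<Sum>j<J. \<Sum>k<M. \<Sum>l<M. \<gamma> j * (\<rho> j k l - \<beta> j) * ?u j k l)"
    by (simp add: sum_subtractf[symmetric] algebra_simps diff_divide_distrib)
  also have "norm \<dots> \<le> (\<Sum>j<J. \<Sum>k<M. \<Sum>l<M. norm (\<gamma> j) * \<epsilon> * (1 / M ^ 2))"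
  proof (intro sum_norm_le)
    fix j k l assume "j \<in> {..<J}" "k \<in> {..<M}" "l \<in> {..<M}"
    then show "norm (\<gamma> j * (\<rho> j k l - \<beta> j) * ?u j k l) \<le> norm (\<gamma> j) * \<epsilon> * (1 / M ^ 2)"
      using \<rho>[of j k l]
      by (auto simp: norm_mult norm_divide norm_power assms intro!: mult_left_mono divide_right_mono)
  qed
  also have "\<dots> = (\<Sum>j<J. norm (\<gamma> j)) * \<epsilon>"
    using assms(3) by (simp add: sum_distrib_right power2_eq_square)
  finally show ?thesis .
qed

text \<open>The weights solve \<open>\<Sum>\<gamma>\<^sub>j = \<Sum>\<gamma>\<^sub>j j\<^sup>2 = 0\<close> and \<open>\<Sum>\<gamma>\<^sub>j j = 2\<close> over \<open>j < 3\<close>.\<close>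

definition weight :: "nat \<Rightarrow> complex" where
  "weight j = (if j = 0 then -3 else if j = 1 then 4 else -1)"

text \<open>Square \<open>j\<close> has its corner at \<open>(j * R, R)\<close>, so its frequencies
  have slope close to \<open>j\<close> when \<open>R\<close> is large compared with
  \<open>M\<close>. Dividing by the square of the second frequency normalises
  \<open>Dyy\<close>.\<close>

definition block :: "nat \<Rightarrow> nat \<Rightarrow> int \<times> int \<Rightarrow> complex" where
  "block M R n = (\<Sum>(j, k, l)\<in>{..<3} \<times> {..<M} \<times> {..<M}.
     if n = (int (j * R + k), int (R + l)) then weight j / (of_nat M ^ 2 * of_nat (R + l) ^ 2) else 0)"

lemma analytic_coeffs_block: "analytic_coeffs (block M R)"
proof -
  let ?I = "{..<3::nat} \<times> {..<M} \<times> {..<M}"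
  let ?g = "\<lambda>(j, k, l). (int (j * R + k), int (R + l))"
  have zero: "block M R n = 0" if "n \<notin> ?g ` ?I" for n
    unfolding block_def by (rule sum.neutral) (use that in force)
  then have "{n. block M R n \<noteq> 0} \<subseteq> ?g ` ?I" by blast
  moreover have "finite (?g ` ?I)" by simp
  ultimately have "finite {n. block M R n \<noteq> 0}" by (rule finite_subset)
  moreover have "block M R n = 0" if "\<not> (fst n \<ge> 0 \<and> snd n \<ge> 0)" for n
    by (rule zero) (use that in auto)
  ultimately show ?thesis by (auto simp: analytic_coeffs_def)
qed

text \<open>Because \<open>p + q = 2\<close>, the normalising square splits as a \<open>p\<close>-th
  times a \<open>q\<close>-th power. It cancels the second frequency and leaves only the slope to
  the power \<open>p\<close>.\<close>

lemma trig_sum_moment_block: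
  assumes "R > 0" "p + q = 2"
  shows "trig_sum (moment p q (block M R)) x y =
    (\<Sum>j<3. \<Sum>k<M. \<Sum>l<M. weight j * (of_nat (j * R + k) / of_nat (R + l)) ^ p / of_nat M ^ 2
        * (cis x ^ (j * R + k) * cis y ^ (R + l)))"
proof -
  let ?I = "{..<3::nat} \<times> {..<M} \<times> {..<M}"
  let ?g = "\<lambda>(j, k, l). (int (j * R + k), int (R + l))"
  let ?d = "\<lambda>(j, k::nat, l). weight j / (of_nat M ^ 2 * of_nat (R + l) ^ 2)"
  let ?h = "\<lambda>n :: int \<times> int. of_int (fst n) ^ p * of_int (snd n) ^ q :: complex"
  have "moment p q (block M R) = (\<lambda>n. ?h n * (\<Sum>i\<in>?I. if n = ?g i then ?d i else 0))"
    by (auto simp: moment_def block_def fun_eq_iff intro!: sum.cong)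
  then have "trig_sum (moment p q (block M R)) x y
      = (\<Sum>i\<in>?I. ?h (?g i) * ?d i * character (?g i) x y)"
    using trig_sum_of_family[of ?I ?h ?g ?d x y] by simp
  also have "\<dots> = (\<Sum>(j, k, l)\<in>?I. weight j * (of_nat (j * R + k) / of_nat (R + l)) ^ p / of_nat M ^ 2
        * (cis x ^ (j * R + k) * cis y ^ (R + l)))"
  proof (intro sum.cong refl)
    fix i assume "i \<in> ?I"
    obtain j k l where i: "i = (j, k, l)" by (cases i)
    have quotient: "u ^ p * v ^ q * (a / (b * v ^ 2)) = a * (u / v) ^ p / b" if "v \<noteq> 0" for u v a b :: complex
      using that unfolding assms(2)[symmetric] by (simp add: power_add power_divide mult.commute)
    have "(of_nat (R + l) :: complex) \<noteq> 0" using assms(1) unfolding of_nat_eq_0_iff by simp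
    then have "?h (int (j * R + k), int (R + l)) * (weight j / (of_nat M ^ 2 * of_nat (R + l) ^ 2))
        = weight j * (of_nat (j * R + k) / of_nat (R + l)) ^ p / of_nat M ^ 2"
      unfolding fst_conv snd_conv of_int_of_nat_eq by (rule quotient)
    then show "?h (?g i) * ?d i * character (?g i) x y
      = (case i of (j, k, l) \<Rightarrow> weight j * (of_nat (j * R + k) / of_nat (R + l)) ^ p / of_nat M ^ 2
        * (cis x ^ (j * R + k) * cis y ^ (R + l)))"
      unfolding i prod.case character_nonneg by metis
  qed
  also have "\<dots> = (\<Sum>j<3. \<Sum>k<M. \<Sum>l<M. weight j * (of_nat (j * R + k) / of_nat (R + l)) ^ p / of_nat M ^ 2
        * (cis x ^ (j * R + k) * cis y ^ (R + l)))"
    by (simp add: sum.cartesian_product)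
  finally show ?thesis .
qed

text \<open>The offsets \<open>k\<close> and \<open>l\<close> are below \<open>M\<close>, whereas
  the corner lies at distance of order \<open>q * M\<close>; the slope therefore moves by at most
  \<open>2 / q\<close>.\<close>

lemma ratio_approx:
  assumes "j < 3" "k < M" "l < M" "q > 0" "p \<le> 2"
  shows "norm ((of_nat (j * (q * M) + k) / of_nat (q * M + l)) ^ p - of_nat j ^ p :: complex) \<le> 12 / q"
proof -
  define t where "t = real (j * (q * M) + k) / real (q * M + l)"
  have M: "M > 0" using assms by auto
  then have pos: "real (q * M + l) > 0" using assms by (simp only: of_nat_0_less_iff add_pos_nonneg mult_pos_pos)
  have qM: "0 < real q * real M" using M assms by simp
  have "t - j = (real k - real j * real l) / real (q * M + l)"
    using pos by (simp add: t_def field_simps)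
  then have "\<bar>t - j\<bar> = \<bar>real k - real j * real l\<bar> / real (q * M + l)"
    using pos by simp
  also have "\<dots> \<le> 2 * real M / real (q * M)"
  proof (intro frac_le)
    have "real j * real l \<le> 2 * real M" using assms by (intro mult_mono) auto
    moreover have "0 \<le> real j * real l" by simp
    moreover have "real k \<le> 2 * real M" "0 \<le> real k" using assms by auto
    ultimately show "\<bar>real k - real j * real l\<bar> \<le> 2 * real M" by linarith
  qed (use qM in auto)
  also have "\<dots> = 2 / q" using M by simp
  finally have d: "\<bar>t - j\<bar> \<le> 2 / q" .
  have q2: "2 / real q \<le> 2" using assms by (simp add: field_simps)
  have "\<bar>t ^ p - real j ^ p\<bar> \<le> 12 / q"
  proof -
    consider "p = 0" | "p = 1" | "p = 2" using assms by linarith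
    then show ?thesis
    proof cases
      case 3
      \<comment> \<open>The number \<open>t\<close> is within 2 of \<open>j\<close>, and
        \<open>j\<close> is at most 2. Factoring the difference of squares then yields the constant
        12.\<close>
      have "\<bar>t + j\<bar> \<le> 6" using d q2 assms(1) by linarith
      then have "\<bar>t - j\<bar> * \<bar>t + j\<bar> \<le> 2 / q * 6" using d by (intro mult_mono) auto
      then show ?thesis using 3 by (simp add: abs_mult[symmetric] power2_eq_square algebra_simps)
    qed (use d in \<open>auto intro: order.trans simp: field_simps\<close>)
  qed
  moreover have "(of_nat (j * (q * M) + k) / of_nat (q * M + l)) ^ p - of_nat j ^ p
      = complex_of_real (t ^ p - real j ^ p)"
    by (simp add: t_def)
  ultimately show ?thesis by (metis norm_of_real)
qed

lemma trig_sum_moment_block_approx: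
  assumes "M > 0" "Q > 0" "p + q = 2"
  shows "norm (trig_sum (moment p q (block M (Q * M))) x y
          - (\<Sum>j<3. weight j * of_nat j ^ p * cis x ^ (j * (Q * M))) * cis y ^ (Q * M)
            * geo_mean M (cis x) * geo_mean M (cis y)) \<le> 96 / Q"
proof -
  \<comment> \<open>The norms of the weights add up to 3 + 4 + 1 = 8.\<close>
  have W: "(\<Sum>j<3. norm (weight j)) * (12 / real Q) = 96 / Q"
    by (simp add: weight_def numeral_3_eq_3)
  show ?thesis
    unfolding W[symmetric]
    by (subst trig_sum_moment_block, use assms in simp, use assms in simp)
      (rule block_approx, use assms in \<open>auto intro!: ratio_approx simp del: of_nat_add of_nat_mult\<close>)
qed

text \<open>Two independent parameters are at work: \<open>M\<close> makes the kernels small away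
  from the origin, and \<open>Q\<close> brings the slopes close to 0, 1, 2. The slope error and the
  decay each receive half of \<open>\<eta>\<close>.\<close>

lemma block_exists:
  assumes "\<delta> > 0" "0 < \<eta>" "\<eta> \<le> 1"
  obtains d where "analytic_coeffs d"
    and "\<And>p q x y. (p, q) \<in> {(2, 0), (0, 2)} \<Longrightarrow> norm (trig_sum (moment p q d) x y) \<le> 9"
    and "\<And>p q. (p, q) \<in> {(2, 0), (0, 2)} \<Longrightarrow> norm (trig_sum (moment p q d) 0 0) \<le> \<eta>"
    and "\<And>p q x y. (p, q) \<in> {(2, 0), (0, 2)} \<Longrightarrow> \<delta> \<le> norm (cis x - 1) \<or> \<delta> \<le> norm (cis y - 1) \<Longrightarrow>
           norm (trig_sum (moment p q d) x y) \<le> \<eta>"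
    and "Re (trig_sum (moment 1 1 d) 0 0) \<ge> 1"
proof -
  obtain M :: nat where M0: "real M > 32 / (\<delta> * \<eta>)" using reals_Archimedean2 by blast
  obtain Q :: nat where Q0: "real Q > 192 / \<eta>" using reals_Archimedean2 by blast
  have "32 / (\<delta> * \<eta>) > 0" "192 / \<eta> > 0" using assms by auto
  then have M: "M > 0" and Q: "Q > 0" using M0 Q0 by (auto intro!: gr0I)
  have eM: "16 / (M * \<delta>) \<le> \<eta> / 2" using M0 M assms by (simp add: field_simps)
  have eQ: "96 / Q \<le> \<eta> / 2" using Q0 Q assms by (simp add: field_simps)
  define d where "d = block M (Q * M)"
  define a where "a p x = (\<Sum>j<3. weight j * of_nat j ^ p * cis x ^ (j * (Q * M)))" for p x
  define m where "m p x y = a p x * cis y ^ (Q * M) * geo_mean M (cis x) * geo_mean M (cis y)" for p x y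
  have approx: "norm (trig_sum (moment p q d) x y - m p x y) \<le> \<eta> / 2" if "p + q = 2" for p q x y
    using trig_sum_moment_block_approx[OF M Q that, of x y] eQ unfolding d_def m_def a_def by linarith
  then have le: "norm (trig_sum (moment p q d) x y) \<le> norm (m p x y) + \<eta> / 2"
    if "p + q = 2" for p q x y
    using that norm_triangle_sub[of "trig_sum (moment p q d) x y" "m p x y"]
    by (meson add_left_mono order_trans)
  have geo1: "geo_mean M 1 = 1" using M by (simp add: geo_mean_def)
  \<comment> \<open>The bound is attained by both sums: 3 + 4 + 1 for \<open>p = 0\<close> and 4 + 4
    for \<open>p = 2\<close>.\<close>
  have a8: "norm (a p x) \<le> 8" if "p \<in> {0, 2}" for p x
  proof -
    have "norm (a p x) \<le> (\<Sum>j<3. norm (weight j) * real j ^ p)"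
      unfolding a_def by (rule sum_norm_le) (simp add: norm_mult norm_power)
    also have "\<dots> \<le> 8" using that by (auto simp: weight_def numeral_3_eq_3)
    finally show ?thesis .
  qed
  have m_eq: "norm (m p x y) = norm (a p x) * (norm (geo_mean M (cis x)) * norm (geo_mean M (cis y)))"
    for p x y by (simp add: m_def norm_mult norm_power)
  show thesis
  proof (rule that[of d])
    show "analytic_coeffs d" unfolding d_def by (rule analytic_coeffs_block)
    fix p q :: nat assume pq: "(p, q) \<in> {(2, 0), (0, 2)}"
    then have sum: "p + q = 2" and p: "p \<in> {0, 2}" by auto
    \<comment> \<open>At the origin only the weighted sum of \<open>j ^ p\<close> matters, and the
      weights annihilate it for \<open>p = 0\<close> and \<open>p = 2\<close>.\<close>
    have "m p 0 0 = 0"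
      using p by (auto simp: m_def a_def weight_def numeral_3_eq_3)
    then show "norm (trig_sum (moment p q d) 0 0) \<le> \<eta>"
      using le[OF sum, of 0 0] assms by simp
    fix x y
    have "norm (m p x y) \<le> 8 * (1 * 1)"
      unfolding m_eq by (intro mult_mono a8 p norm_geo_mean_le_1) auto
    then show "norm (trig_sum (moment p q d) x y) \<le> 9"
      using le[OF sum, of x y] assms by simp
    assume away: "\<delta> \<le> norm (cis x - 1) \<or> \<delta> \<le> norm (cis y - 1)"
    have "norm (geo_mean M (cis x)) * norm (geo_mean M (cis y)) \<le> 2 / (M * \<delta>)"
      using away
    proof
      assume "\<delta> \<le> norm (cis x - 1)"
      then have "norm (geo_mean M (cis x)) * norm (geo_mean M (cis y)) \<le> 2 / (M * \<delta>) * 1"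
        using assms M by (intro mult_mono norm_geo_mean_le norm_geo_mean_le_1) auto
      then show ?thesis by simp
    next
      assume "\<delta> \<le> norm (cis y - 1)"
      then have "norm (geo_mean M (cis x)) * norm (geo_mean M (cis y)) \<le> 1 * (2 / (M * \<delta>))"
        using assms M by (intro mult_mono norm_geo_mean_le norm_geo_mean_le_1) auto
      then show ?thesis by simp
    qed
    then have "norm (m p x y) \<le> 8 * (2 / (M * \<delta>))"
      unfolding m_eq by (intro mult_mono a8 p) auto
    then show "norm (trig_sum (moment p q d) x y) \<le> \<eta>"
      using le[OF sum, of x y] eM by simp
  next
    have "m 1 0 0 = 2"
      by (simp add: m_def a_def geo1 weight_def numeral_3_eq_3)
    then have "norm (trig_sum (moment 1 1 d) 0 0 - 2) \<le> \<eta> / 2"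
      using approx[of 1 1 0 0] by simp
    then have "\<bar>Re (trig_sum (moment 1 1 d) 0 0 - 2)\<bar> \<le> \<eta> / 2"
      using abs_Re_le_cmod order_trans by blast
    then show "Re (trig_sum (moment 1 1 d) 0 0) \<ge> 1"
      using assms unfolding minus_complex.simps complex_Re_numeral by linarith
  qed
qed

section \<open>Superposition of blocks\<close>

text \<open>Bounds do not accumulate, because at each point either the new block or the old sum is
  small. Smallness at the origin belongs to the induction claim since, by continuity, it spreads to
  a neighbourhood in which the next block can be concentrated. The induction is over all
  \<open>\<eta>\<close>, so that the old sum can be taken with \<open>\<eta> / 2\<close>.\<close>

lemma lacunary_sum_exists:
  assumes "0 < \<eta>" "\<eta> \<le> 1"
  shows "\<exists>c. analytic_coeffs c \<and>
    (\<forall>(p, q)\<in>{(2, 0), (0, 2)}. (\<forall>x y. norm (trig_sum (moment p q c) x y) \<le> 9 + \<eta>) \<and>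
       norm (trig_sum (moment p q c) 0 0) \<le> \<eta>) \<and>
    Re (trig_sum (moment 1 1 c) 0 0) \<ge> real L"
  using assms
proof (induction L arbitrary: \<eta>)
  case 0
  have "analytic_coeffs (\<lambda>_. 0)" by (simp add: analytic_coeffs_def)
  moreover have "trig_sum (moment p q (\<lambda>_. 0)) x y = 0" for p q x y
    by (simp add: trig_sum_def moment_def)
  ultimately show ?case using 0 by (intro exI[of _ "\<lambda>_. 0"]) auto
next
  case (Suc L)
  then obtain c where c: "analytic_coeffs c"
    "\<And>p q x y. (p, q) \<in> {(2, 0), (0, 2)} \<Longrightarrow> norm (trig_sum (moment p q c) x y) \<le> 9 + \<eta> / 2"
    "\<And>p q. (p, q) \<in> {(2, 0), (0, 2)} \<Longrightarrow> norm (trig_sum (moment p q c) 0 0) \<le> \<eta> / 2"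
    "Re (trig_sum (moment 1 1 c) 0 0) \<ge> real L"
    using Suc.IH[of "\<eta> / 2"] by fastforce
  have cont: "\<exists>\<delta>>0. \<forall>x y. norm (cis x - 1) < \<delta> \<longrightarrow> norm (cis y - 1) < \<delta> \<longrightarrow>
           norm (trig_sum (moment p q c) x y - trig_sum (moment p q c) 0 0) < \<eta> / 2" for p q
    using Suc.prems by (intro trig_sum_continuous_at_0 analytic_coeffs_moment c(1)) auto
  obtain \<delta>1 where \<delta>1: "\<delta>1 > 0" "\<And>x y. norm (cis x - 1) < \<delta>1 \<Longrightarrow> norm (cis y - 1) < \<delta>1 \<Longrightarrow>
           norm (trig_sum (moment 2 0 c) x y - trig_sum (moment 2 0 c) 0 0) < \<eta> / 2"
    using cont[of 2 0] by blast
  obtain \<delta>2 where \<delta>2: "\<delta>2 > 0" "\<And>x y. norm (cis x - 1) < \<delta>2 \<Longrightarrow> norm (cis y - 1) < \<delta>2 \<Longrightarrow>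
           norm (trig_sum (moment 0 2 c) x y - trig_sum (moment 0 2 c) 0 0) < \<eta> / 2"
    using cont[of 0 2] by blast
  define \<delta> where "\<delta> = min \<delta>1 \<delta>2"
  have "\<delta> > 0" using \<delta>1 \<delta>2 by (simp add: \<delta>_def)
  moreover have "0 < \<eta> / 2" "\<eta> / 2 \<le> 1" using Suc.prems by auto
  ultimately obtain d where d: "analytic_coeffs d"
    "\<And>p q x y. (p, q) \<in> {(2, 0), (0, 2)} \<Longrightarrow> norm (trig_sum (moment p q d) x y) \<le> 9"
    "\<And>p q. (p, q) \<in> {(2, 0), (0, 2)} \<Longrightarrow> norm (trig_sum (moment p q d) 0 0) \<le> \<eta> / 2"
    "\<And>p q x y. (p, q) \<in> {(2, 0), (0, 2)} \<Longrightarrow> \<delta> \<le> norm (cis x - 1) \<or> \<delta> \<le> norm (cis y - 1) \<Longrightarrow>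
           norm (trig_sum (moment p q d) x y) \<le> \<eta> / 2"
    "Re (trig_sum (moment 1 1 d) 0 0) \<ge> 1"
    using block_exists by metis
  define e where "e = (\<lambda>n. c n + d n)"
  have fin: "finite {n. moment p q c n \<noteq> 0}" "finite {n. moment p q d n \<noteq> 0}" for p q
    using c(1) d(1) by (simp_all add: analytic_coeffs_def finite_support_moment)
  have "moment p q e = (\<lambda>n. moment p q c n + moment p q d n)" for p q
    by (auto simp: e_def moment_def algebra_simps)
  then have add: "trig_sum (moment p q e) x y = trig_sum (moment p q c) x y + trig_sum (moment p q d) x y"
    for p q x y by (simp add: trig_sum_add fin)
  show ?case
  unfolding case_prod_beta
  proof (intro exI[of _ e] conjI ballI allI)
    show "analytic_coeffs e" unfolding e_def by (rule analytic_coeffs_add[OF c(1) d(1)])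
    show "real (Suc L) \<le> Re (trig_sum (moment 1 1 e) 0 0)" using c(4) d(5) by (simp add: add)
    fix pq :: "nat \<times> nat" assume "pq \<in> {(2, 0), (0, 2)}"
    then have pq: "(fst pq, snd pq) \<in> {(2, 0), (0, 2)}" by auto
    let ?F = "\<lambda>c. trig_sum (moment (fst pq) (snd pq) c)"
    show "norm (?F e 0 0) \<le> \<eta>"
      unfolding add using norm_triangle_ineq[of "?F c 0 0" "?F d 0 0"] c(3)[OF pq] d(3)[OF pq]
      by linarith
    fix x y
    show "norm (?F e x y) \<le> 9 + \<eta>"
    \<comment> \<open>Away from the origin the bounds are \<open>9 + \<eta> / 2\<close> for the old
      sum and \<open>\<eta> / 2\<close> for the block. Near it they are \<open>\<eta>\<close> and
      9.\<close>
    proof (cases "\<delta> \<le> norm (cis x - 1) \<or> \<delta> \<le> norm (cis y - 1)")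
      case True
      then show ?thesis
        unfolding add using norm_triangle_ineq[of "?F c x y" "?F d x y"] c(2)[OF pq, of x y] d(4)[OF pq, of x y]
        by linarith
    next
      case False
      then have "norm (?F c x y - ?F c 0 0) < \<eta> / 2"
        using \<delta>1(2)[of x y] \<delta>2(2)[of x y] pq by (auto simp: \<delta>_def)
      then have "norm (?F c x y) \<le> \<eta>"
        using norm_triangle_sub[of "?F c x y" "?F c 0 0"] c(3)[OF pq] by linarith
      then show ?thesis
        unfolding add using norm_triangle_ineq[of "?F c x y" "?F d x y"] d(2)[OF pq, of x y]
        by linarith
    qed
  qed
qed

section \<open>Rescaling to the supremum norms\<close>

lemma sup_norm_le:
  assumes "\<And>x y. norm (g x y) \<le> B"
  shows "sup_norm g \<le> ennreal B"
  unfolding sup_norm_def by (intro SUP_least ennreal_leI assms)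

theorem theorem1:
  fixes C :: real
  assumes "C > 0"
  shows "\<exists>f. analytic_trig_polynomial f \<and>
             sup_norm (Dxx f) + sup_norm (Dyy f) \<le> 1 \<and>
             sup_norm (Dxy f) > ennreal C"
proof -
  \<comment> \<open>With \<open>\<eta> = 1\<close> both pure derivatives are bounded by 10. Dividing
    by 20 leaves \<open>1 / 2\<close> for each, while the mixed derivative at the origin keeps norm
    at least \<open>L / 20\<close>.\<close>
  obtain L :: nat where L: "real L > 20 * C" using reals_Archimedean2 by blast
  obtain c where c: "analytic_coeffs c"
    "\<And>x y. norm (trig_sum (moment 2 0 c) x y) \<le> 10"
    "\<And>x y. norm (trig_sum (moment 0 2 c) x y) \<le> 10"
    "Re (trig_sum (moment 1 1 c) 0 0) \<ge> real L"
    using lacunary_sum_exists[of 1 L] by auto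
  define e where "e = (\<lambda>n. 1 / 20 * c n)"
  have fin: "finite {n. e n \<noteq> 0}" "finite {n. moment p q c n \<noteq> 0}" for p q
    using c(1) by (simp_all add: analytic_coeffs_def e_def finite_support_moment)
  have "moment p q e = (\<lambda>n. 1 / 20 * moment p q c n)" for p q
    by (auto simp: e_def moment_def)
  then have scale: "trig_sum (moment p q e) x y = 1 / 20 * trig_sum (moment p q c) x y" for p q x y
    by (simp only: trig_sum_cmult[OF fin(2)])
  have "analytic_trig_polynomial (trig_sum e)"
    unfolding analytic_trig_polynomial_def
    by (intro exI[of _ e]) (use c(1) fin in \<open>auto simp: analytic_coeffs_def e_def\<close>)
  moreover have "sup_norm (Dxx (trig_sum e)) \<le> ennreal (1 / 2)"
    using c(2) by (intro sup_norm_le) (simp add: second_derivatives_trig_sum[OF fin(1)] scale norm_divide)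
  moreover have "sup_norm (Dyy (trig_sum e)) \<le> ennreal (1 / 2)"
    using c(3) by (intro sup_norm_le) (simp add: second_derivatives_trig_sum[OF fin(1)] scale norm_divide)
  moreover have "ennreal (1 / 2) + ennreal (1 / 2) = 1"
    by (subst ennreal_plus[symmetric]) auto
  moreover have "ennreal C < sup_norm (Dxy (trig_sum e))"
  proof -
    have "20 * C < norm (trig_sum (moment 1 1 c) 0 0)"
      using L c(4) complex_Re_le_cmod[of "trig_sum (moment 1 1 c) 0 0"] by linarith
    then have "C < norm (Dxy (trig_sum e) 0 0)"
      by (simp add: second_derivatives_trig_sum[OF fin(1)] scale norm_divide)
    then have "ennreal C < ennreal (norm (Dxy (trig_sum e) 0 0))"
      using assms by (simp add: ennreal_less_iff)
    also have "\<dots> \<le> sup_norm (Dxy (trig_sum e))"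
      unfolding sup_norm_def by (rule SUP_upper2[of "(0, 0)"]) auto
    finally show ?thesis .
  qed
  ultimately show ?thesis by (metis add_mono)
qed

end
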